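(* There exists a non-elliptic semigroup $(\phi_t)_{t\ge0}$ of holomorphic self-maps of the unit disk $\mathbb{D}$ such that its total speed $v$ is not an eventually increasing function.
   Context: $\mathbb{D}=\{z\in\mathbb{C}:|z|<1\}$. A family $(\phi_t)_{t\ge 0}$ of holomorphic maps $\phi_t:\mathbb{D}\to\mathbb{D}$ is a semigroup if (a) $\phi_0$ is the identity; (b) $\phi_{t+s}=\phi_t\circ\phi_s$ for all $t,s\ge 0$; (c) $\lim_{t\to s}\phi_t(z)=\phi_s(z)$ for every $s\ge 0$ and $z\in\mathbb{D}$. It is non-elliptic if for every $t>0$ the map $\phi_t$ has no fixed points in $\mathbb{D}$. The hyperbolic distance $\rho_{\mathbb{D}}$ is the distance induced by the metric $|dz|/(1-|z|^2)$, i.e. $\rho_{\mathbb{D}}(z,w)=\frac12\log\frac{1+|T(z,w)|}{1-|T(z,w)|}$ with $T(z,w)=\frac{z-w}{1-z\overline{w}}$. The total speed of the semigroup is $v(t)=\rho_{\mathbb{D}}(0,\phi_t(0))$, $t\ge 0$. "Increasing" is meant in the weak sense ($s\le t$ implies $v(s)\le v(t)$), and "eventually increasing" means increasing on $[t_0,+\infty)$ for some $t_0\ge 0$. *)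

theory Defs
  imports "HOL-Complex_Analysis.Complex_Analysis"
begin

abbreviation unit_disc :: "complex set" (\<open>\<bbbD>\<close>) where
  "\<bbbD> \<equiv> ball 0 1"

(* Time is a real number restricted to [0,\<infinity>); the values of \<phi> at negative times and
   outside the disc are irrelevant, so the identities are required on \<bbbD> only. *)

definition holomorphic_semigroup :: "(real \<Rightarrow> complex \<Rightarrow> complex) \<Rightarrow> bool" where
  "holomorphic_semigroup \<phi> \<longleftrightarrow>
     (\<forall>t\<ge>0. \<phi> t holomorphic_on \<bbbD> \<and> \<phi> t ` \<bbbD> \<subseteq> \<bbbD>) \<and>
     (\<forall>z\<in>\<bbbD>. \<phi> 0 z = z) \<and>
     (\<forall>t\<ge>0. \<forall>s\<ge>0. \<forall>z\<in>\<bbbD>. \<phi> (t + s) z = \<phi> t (\<phi> s z)) \<and>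
     (\<forall>s\<ge>0. \<forall>z\<in>\<bbbD>. ((\<lambda>t. \<phi> t z) \<longlongrightarrow> \<phi> s z) (at s within {0..}))"

definition non_elliptic :: "(real \<Rightarrow> complex \<Rightarrow> complex) \<Rightarrow> bool" where
  "non_elliptic \<phi> \<longleftrightarrow> (\<forall>t>0. \<not> (\<exists>z\<in>\<bbbD>. \<phi> t z = z))"

definition pseudo_T :: "complex \<Rightarrow> complex \<Rightarrow> complex" where
  "pseudo_T z w = (z - w) / (1 - z * cnj w)"

(* Normalised to curvature -4, i.e. the distance of the metric |dz| / (1 - |z|^2). *)
definition hyperbolic_dist :: "complex \<Rightarrow> complex \<Rightarrow> real" where
  "hyperbolic_dist z w =
     1 / 2 * ln ((1 + cmod (pseudo_T z w)) / (1 - cmod (pseudo_T z w)))"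

definition total_speed :: "(real \<Rightarrow> complex \<Rightarrow> complex) \<Rightarrow> real \<Rightarrow> real" where
  "total_speed \<phi> t = hyperbolic_dist 0 (\<phi> t 0)"

(* Weakly increasing on some half-line [t0,\<infinity>). *)
definition eventually_increasing :: "(real \<Rightarrow> real) \<Rightarrow> bool" where
  "eventually_increasing v \<longleftrightarrow> (\<exists>t0\<ge>0. mono_on {t0..} v)"

end

theory Submission
  imports Defs
begin

text \<open>
  In the right half-plane, a holomorphic \<open>h\<close> with \<open>Re h' \<ge> 1\<close> is injective with 1-Lipschitz
  inverse, and its image is invariant under translation by \<open>t \<ge> 0\<close>; so \<open>h\<^sup>-\<^sup>1 (h w + t)\<close> is a
  semigroup with Koenigs map \<open>h\<close>. The speed of the orbit \<open>w(t)\<close> of \<open>1\<close> is a decreasing function of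
  \<open>Re w / |w + 1|\<^sup>2\<close>, for large \<open>w\<close> essentially \<open>Re (1/w)\<close>. If \<open>h (L w) = L h w\<close> for some
  \<open>L > 1\<close>, the rescaled orbits \<open>w(L\<^sup>n s) / L\<^sup>n\<close> converge to \<open>h\<^sup>-\<^sup>1(s)\<close>, so it suffices that
  \<open>Re (1 / h\<^sup>-\<^sup>1(s))\<close> has positive derivative at one \<open>s > 0\<close>. This is achieved by
  \<open>h' = \<i> M + (2 + \<zeta>)\<^sup>2\<close>, where \<open>\<zeta> = exp (- 2 \<pi>) w\<^sup>4\<^sup>\<i>\<close> has modulus less than 1 and \<open>M\<close> is large, so
  that the orbit stays close to the imaginary axis.
\<close>

section \<open>Expansion, injectivity and translation-invariant image\<close>

abbreviation right_half_plane :: "complex set" where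
  "right_half_plane \<equiv> {w. 0 < Re w}"

locale koenigs_map =
  fixes h :: "complex \<Rightarrow> complex"
  assumes holo: "h holomorphic_on right_half_plane"
    and deriv_ge: "\<And>w. 0 < Re w \<Longrightarrow> 1 \<le> Re (deriv h w)"
begin

lemma has_deriv: "0 < Re w \<Longrightarrow> (h has_field_derivative deriv h w) (at w)"
  using holomorphic_derivI[OF holo open_halfspace_Re_gt] by auto

text \<open>Mean value theorem along the segment from \<open>a\<close> to \<open>b\<close>, which
  stays in the half-plane by convexity. Multiplying by \<open>cnj (b - a)\<close> makes the
  derivative equal to \<open>Re h'\<close> times |b - a|^2.\<close>

lemma expanding:
  assumes a: "0 < Re a" and b: "0 < Re b"
  shows "(cmod (b - a))\<^sup>2 \<le> Re ((h b - h a) * cnj (b - a))"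
proof -
  define f where "f = (\<lambda>t::real. Re (h (a + of_real t * (b - a)) * cnj (b - a)))"
  define f' where "f' = (\<lambda>t::real. Re (deriv h (a + of_real t * (b - a)) * (b - a) * cnj (b - a)))"
  have pos: "0 < Re (a + of_real t * (b - a))" if "0 \<le> t" "t \<le> 1" for t :: real
  proof -
    have "(1 - t) *\<^sub>R a + t *\<^sub>R b \<in> right_half_plane"
      using convexD[OF convex_halfspace_Re_gt[of 0], of a b "1 - t" t] a b that by simp
    then show ?thesis by (simp add: algebra_simps scaleR_conv_of_real)
  qed
  have D: "(f has_real_derivative f' t) (at t)" if "0 \<le> t" "t \<le> 1" for t
  proof -
    have 1: "((\<lambda>z. h (a + z * (b - a)) * cnj (b - a)) has_field_derivative
        deriv h (a + of_real t * (b - a)) * (b - a) * cnj (b - a)) (at (of_real t))"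
      by (rule derivative_eq_intros DERIV_chain'[OF _ has_deriv] pos that refl | simp)+
    show ?thesis unfolding f_def f'_def
      by (rule has_field_derivative_Re[OF has_vector_derivative_real_field[OF 1]])
  qed
  obtain t where t: "0 < t" "t < 1" "f 1 - f 0 = (1 - 0) * f' t"
    using MVT2[of 0 1 f f'] D by auto
  have "f' t = Re (deriv h (a + of_real t * (b - a)) * of_real ((cmod (b - a))\<^sup>2))"
    unfolding f'_def by (simp only: mult.assoc complex_norm_square)
  then have "f' t = Re (deriv h (a + of_real t * (b - a))) * (cmod (b - a))\<^sup>2"
    by simp
  also have "\<dots> \<ge> 1 * (cmod (b - a))\<^sup>2"
    using deriv_ge[OF pos[of t]] t by (intro mult_right_mono) auto
  finally have "(cmod (b - a))\<^sup>2 \<le> f 1 - f 0" using t by simp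
  then show ?thesis by (simp add: f_def algebra_simps)
qed

lemma dist_le:
  assumes "0 < Re a" "0 < Re b"
  shows "cmod (b - a) \<le> cmod (h b - h a)"
proof (cases "a = b")
  case False
  have "cmod (b - a) * cmod (b - a) \<le> cmod ((h b - h a) * cnj (b - a))"
    using expanding[OF assms] complex_Re_le_cmod[of "(h b - h a) * cnj (b - a)"]
    by (simp add: power2_eq_square)
  also have "\<dots> = cmod (h b - h a) * cmod (b - a)"
    by (simp only: norm_mult complex_mod_cnj)
  finally show ?thesis using False by simp
qed simp

lemma inj: "inj_on h right_half_plane"
  using dist_le by (intro inj_onI) fastforce

text \<open>For a real difference \<open>t\<close> of the values, \<open>expanding\<close> reads |b
  - a|^2 \<le> t Re (b - a). This keeps limits of preimages away from the imaginary axis in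
  \<open>translate_in_image\<close>.\<close>

lemma Re_le_of_translate:
  assumes "0 < Re a" "0 < Re b" "h b = h a + of_real t" "0 \<le> t"
  shows "Re a \<le> Re b"
proof (cases "t = 0")
  case True
  then show ?thesis using dist_le[OF assms(1,2)] assms(3) by simp
next
  case False
  have "0 \<le> (cmod (b - a))\<^sup>2" by simp
  also have "\<dots> \<le> t * Re (b - a)"
    using expanding[OF assms(1,2)] assms(3) by simp
  finally show ?thesis using False assms(4) by (simp add: zero_le_mult_iff)
qed

lemma open_image: "open (h ` right_half_plane)"
  using open_mapping_thm3[OF holo open_halfspace_Re_gt inj] .

text \<open>Connectedness of [0, \<infinity>): the times \<open>t\<close> at which the translate
  lies in the image form a set that contains 0 and is relatively open and closed.\<close>

lemma translate_in_image:
  assumes a: "0 < Re a" and t: "0 \<le> t"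
  shows "h a + of_real t \<in> h ` right_half_plane"
proof -
  define S where "S = {0..} \<inter> (\<lambda>t::real. h a + of_real t) -` (h ` right_half_plane)"
  have "openin (top_of_set {0..}) S"
    unfolding S_def by (intro continuous_openin_preimage_gen open_image continuous_intros)
  \<comment> \<open>Preimages \<open>b n\<close> along a convergent sequence of times are Cauchy by
    \<open>dist_le\<close>, and their limit has real part at least \<open>Re a\<close> > 0.\<close>
  moreover have "closed S"
    unfolding closed_sequential_limits
  proof (intro allI impI, elim conjE)
    fix x l assume x: "\<forall>n. x n \<in> S" and l: "x \<longlonglongrightarrow> l"
    then have "\<forall>n. \<exists>b. 0 < Re b \<and> h b = h a + of_real (x n)"
      unfolding S_def by (auto simp: image_iff) (metis)
    then obtain b where b: "\<And>n. 0 < Re (b n)" "\<And>n. h (b n) = h a + of_real (x n)"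
      by metis
    have x0: "0 \<le> x n" for n using x by (auto simp: S_def)
    have le: "dist (b m) (b n) \<le> dist (x m) (x n)" for m n
      using dist_le[OF b(1)[of n] b(1)[of m]]
      by (simp add: dist_norm b(2) flip: of_real_diff)
    have "Cauchy b"
      using LIMSEQ_imp_Cauchy[OF l] le unfolding Cauchy_def by (meson le_less_trans)
    then obtain c where c: "b \<longlonglongrightarrow> c" using Cauchy_convergent convergent_def by blast
    have "Re a \<le> Re c"
      by (rule LIMSEQ_le_const[OF tendsto_Re[OF c]])
        (use Re_le_of_translate[OF a b x0] in auto)
    then have c0: "0 < Re c" using a by simp
    have "(\<lambda>n. h (b n)) \<longlonglongrightarrow> h c"
      using isCont_tendsto_compose[OF DERIV_isCont[OF has_deriv[OF c0]] c] .
    moreover have "(\<lambda>n. h (b n)) \<longlonglongrightarrow> h a + of_real l"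
      unfolding b(2) by (intro tendsto_intros l)
    ultimately have "h a + of_real l = h c" using LIMSEQ_unique by blast
    moreover have "0 \<le> l" using LIMSEQ_le_const[OF l] x0 by auto
    ultimately show "l \<in> S" using c0 unfolding S_def by auto
  qed
  then have "closedin (top_of_set {0..}) S"
    by (intro closed_subset) (auto simp: S_def)
  moreover have "connected ({0..} :: real set)" by simp
  moreover have "0 \<in> S" using a by (auto simp: S_def)
  ultimately have "S = {0..}" unfolding connected_clopen by blast
  with t show ?thesis by (auto simp: S_def)
qed

section \<open>The semigroup on the half-plane\<close>

definition flow :: "real \<Rightarrow> complex \<Rightarrow> complex" where
  "flow t w = inv_into right_half_plane h (h w + of_real t)"

lemma
  assumes "0 < Re w" "0 \<le> t"
  shows Re_flow: "0 < Re (flow t w)" and h_flow: "h (flow t w) = h w + of_real t"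
  using inv_into_into[OF translate_in_image[OF assms]] f_inv_into_f[OF translate_in_image[OF assms]]
  by (auto simp: flow_def)

lemma flow_eqI: "0 < Re b \<Longrightarrow> h b = h w + of_real t \<Longrightarrow> flow t w = b"
  unfolding flow_def by (metis inv_into_f_f[OF inj] mem_Collect_eq)

lemma flow_holomorphic:
  assumes "0 \<le> t"
  shows "flow t holomorphic_on right_half_plane"
proof -
  \<comment> \<open>A holomorphic inverse \<open>g\<close> agrees with \<open>inv_into\<close> on
    the image of \<open>h\<close>, so holomorphy passes from \<open>g\<close> to
    \<open>flow t\<close>.\<close>
  obtain g where g: "g holomorphic_on h ` right_half_plane"
    "\<And>z. z \<in> right_half_plane \<Longrightarrow> g (h z) = z"
    using holomorphic_has_inverse[OF holo open_halfspace_Re_gt inj] by metis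
  have "(g \<circ> (\<lambda>w. h w + of_real t)) holomorphic_on right_half_plane"
    using translate_in_image assms
    by (intro holomorphic_on_compose_gen[OF _ g(1)] holomorphic_intros holo) auto
  then show ?thesis
    by (rule holomorphic_transform) (use g(2) Re_flow h_flow assms in fastforce)
qed

lemma flow_add:
  assumes "0 < Re w" "0 \<le> t" "0 \<le> s"
  shows "flow (t + s) w = flow t (flow s w)"
  using assms by (intro flow_eqI) (simp_all add: Re_flow h_flow)

text \<open>Orbits are 1-Lipschitz in time: \<open>h\<close> turns them into unit-speed translation,
  and its inverse is 1-Lipschitz.\<close>

lemma flow_tendsto:
  assumes "0 < Re w" "0 \<le> s"
  shows "((\<lambda>t. flow t w) \<longlongrightarrow> flow s w) (at s within {0..})"
proof -
  have "\<forall>\<^sub>F t in at s within {0..}. norm (flow t w - flow s w) \<le> norm (t - s)"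
    unfolding eventually_at_filter
  proof (intro always_eventually allI impI)
    fix t :: real assume "t \<in> {0..}"
    then have t: "0 \<le> t" by simp
    show "norm (flow t w - flow s w) \<le> norm (t - s)"
      using dist_le[OF Re_flow[OF assms] Re_flow[OF assms(1) t]]
      by (simp add: h_flow assms t flip: of_real_diff)
  qed
  moreover have "((\<lambda>t. t - s) \<longlongrightarrow> 0) (at s within {0..})"
    by (auto intro!: tendsto_eq_intros)
  ultimately have "((\<lambda>t. flow t w - flow s w) \<longlongrightarrow> 0) (at s within {0..})"
    by (rule Lim_transform_bound)
  then show ?thesis by (rule LIM_zero_cancel)
qed

section \<open>Transfer to the disc\<close>

text \<open>Conjugate of \<open>flow\<close> by the Cayley map z \<mapsto> (1 + z) / (1 - z), which
  sends 0 to 1; hence the orbit of 1 determines the total speed.\<close>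

definition disc_flow :: "real \<Rightarrow> complex \<Rightarrow> complex" where
  "disc_flow t z = (flow t ((1 + z) / (1 - z)) - 1) / (flow t ((1 + z) / (1 - z)) + 1)"

end

lemma Re_cayley_pos:
  assumes "cmod z < 1"
  shows "0 < Re ((1 + z) / (1 - z))"
proof -
  have z: "z \<noteq> 1" using assms by auto
  have "(cmod z)\<^sup>2 < 1" using assms by (simp add: power_less_one_iff)
  then have "0 < 1 - (Re z)\<^sup>2 - (Im z)\<^sup>2" by (simp add: cmod_power2)
  moreover have "0 < (1 - Re z)\<^sup>2 + (Im z)\<^sup>2"
    using z by (auto simp: complex_eq_iff sum_power2_gt_zero_iff)
  ultimately show ?thesis
    by (simp add: Re_divide) (simp add: algebra_simps power2_eq_square)
qed

lemma cmod_cayley_less_1: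
  assumes "0 < Re w"
  shows "cmod ((w - 1) / (w + 1)) < 1"
proof -
  have "w \<noteq> -1" using assms by auto
  moreover have "(cmod (w - 1))\<^sup>2 < (cmod (w + 1))\<^sup>2"
    using assms unfolding cmod_power2 by (simp add: power2_eq_square algebra_simps)
  then have "cmod (w - 1) < cmod (w + 1)" by (rule power_less_imp_less_base) simp
  ultimately show ?thesis by (simp add: norm_divide divide_less_eq_1 add_eq_0_iff)
qed

lemma cayley_inverse:
  assumes "0 < Re w"
  shows "(1 + (w - 1) / (w + 1)) / (1 - (w - 1) / (w + 1)) = (w::complex)"
proof -
  have "w + 1 \<noteq> 0" using assms by (auto simp: complex_eq_iff)
  then have "1 + (w - 1) / (w + 1) = 2 * w / (w + 1)" "1 - (w - 1) / (w + 1) = 2 / (w + 1)"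
    by (simp_all add: field_simps)
  then show ?thesis using \<open>w + 1 \<noteq> 0\<close> by simp
qed

context koenigs_map
begin

lemma cayley_disc_flow:
  assumes "cmod z < 1" "0 \<le> t"
  shows "(1 + disc_flow t z) / (1 - disc_flow t z) = flow t ((1 + z) / (1 - z))"
  unfolding disc_flow_def using cayley_inverse[OF Re_flow[OF Re_cayley_pos[OF assms(1)] assms(2)]] .

lemma holomorphic_semigroup_disc_flow: "holomorphic_semigroup disc_flow"
  unfolding holomorphic_semigroup_def
proof (intro conjI allI impI ballI)
  have ne: "flow t ((1 + z) / (1 - z)) + 1 \<noteq> 0" if "0 \<le> t" "cmod z < 1" for t z
    using Re_flow[OF Re_cayley_pos[OF that(2)] that(1)] by (auto simp: complex_eq_iff)
  {
    fix t :: real assume t: "0 \<le> t"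
    have "(flow t \<circ> (\<lambda>z. (1 + z) / (1 - z))) holomorphic_on \<bbbD>"
      by (intro holomorphic_on_compose_gen[OF _ flow_holomorphic[OF t]] holomorphic_intros)
        (auto intro: Re_cayley_pos)
    then have "(\<lambda>z. flow t ((1 + z) / (1 - z))) holomorphic_on \<bbbD>" by (simp add: o_def)
    then show "disc_flow t holomorphic_on \<bbbD>"
      unfolding disc_flow_def[abs_def] by (intro holomorphic_intros) (auto simp: ne t)
    show "disc_flow t ` \<bbbD> \<subseteq> \<bbbD>"
      using t by (auto simp: disc_flow_def intro!: cmod_cayley_less_1 Re_flow Re_cayley_pos)
  }
  {
    fix z assume z: "z \<in> \<bbbD>"
    then have "z \<noteq> 1" by auto
    have eq: "flow 0 ((1 + z) / (1 - z)) = (1 + z) / (1 - z)"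
      using z by (intro flow_eqI Re_cayley_pos) auto
    have "(1 + z) / (1 - z) - 1 = 2 * z / (1 - z)" "(1 + z) / (1 - z) + 1 = 2 / (1 - z)"
      using \<open>z \<noteq> 1\<close> by (simp_all add: field_simps)
    then show "disc_flow 0 z = z"
      unfolding disc_flow_def eq using \<open>z \<noteq> 1\<close> by simp
  }
  {
    fix t s :: real and z assume "0 \<le> t" "0 \<le> s" "z \<in> \<bbbD>"
    then show "disc_flow (t + s) z = disc_flow t (disc_flow s z)"
      using cayley_disc_flow[of z s] flow_add[OF Re_cayley_pos[of z]]
      by (subst (1 2) disc_flow_def) simp
  }
  {
    fix s :: real and z assume "0 \<le> s" "z \<in> \<bbbD>"
    then show "((\<lambda>t. disc_flow t z) \<longlongrightarrow> disc_flow s z) (at s within {0..})"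
      unfolding disc_flow_def by (intro tendsto_intros flow_tendsto Re_cayley_pos ne) auto
  }
qed

text \<open>A fixed point would give a half-plane point where \<open>h\<close> equals
  \<open>h + t\<close> with t > 0.\<close>

lemma non_elliptic_disc_flow: "non_elliptic disc_flow"
  unfolding non_elliptic_def
proof (intro allI impI notI, elim bexE)
  fix t :: real and z assume t: "0 < t" and z: "z \<in> \<bbbD>" and fixed: "disc_flow t z = z"
  have "flow t ((1 + z) / (1 - z)) = (1 + z) / (1 - z)"
    using cayley_disc_flow[of z t] t z fixed by simp
  then show False using h_flow[OF Re_cayley_pos[of z], of t] t z by simp
qed

end

section \<open>Total speed in half-plane coordinates\<close>

lemma hyperbolic_dist_0_le_iff:
  assumes "cmod z < 1" "cmod w < 1"
  shows "hyperbolic_dist 0 z \<le> hyperbolic_dist 0 w \<longleftrightarrow> cmod z \<le> cmod w"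
proof -
  have eq: "hyperbolic_dist 0 u = ln ((1 + cmod u) / (1 - cmod u)) / 2" for u
    by (simp add: hyperbolic_dist_def pseudo_T_def)
  have "0 < (1 + cmod u) / (1 - cmod u)" if "cmod u < 1" for u
    using that by (intro divide_pos_pos add_pos_nonneg) auto
  then have "hyperbolic_dist 0 z \<le> hyperbolic_dist 0 w \<longleftrightarrow>
      (1 + cmod z) / (1 - cmod z) \<le> (1 + cmod w) / (1 - cmod w)"
    unfolding eq using assms by simp
  also have "\<dots> \<longleftrightarrow> cmod z \<le> cmod w"
    using assms by (simp add: divide_simps algebra_simps)
  finally show ?thesis .
qed

text \<open>Since |w - 1|^2 = |w + 1|^2 - 4 Re w, the squared modulus of the Cayley image is 1 - 4
  Re w / |w + 1|^2.\<close>

lemma cmod_cayley_le_iff: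
  assumes "0 < Re a" "0 < Re b"
  shows "cmod ((a - 1) / (a + 1)) \<le> cmod ((b - 1) / (b + 1)) \<longleftrightarrow>
    Re b / (cmod (b + 1))\<^sup>2 \<le> Re a / (cmod (a + 1))\<^sup>2"
proof -
  have eq: "(cmod ((w - 1) / (w + 1)))\<^sup>2 = 1 - 4 * (Re w / (cmod (w + 1))\<^sup>2)" if "0 < Re w" for w
  proof -
    have "w + 1 \<noteq> 0" using that by (auto simp: complex_eq_iff)
    moreover have "(cmod (w - 1))\<^sup>2 = (cmod (w + 1))\<^sup>2 - 4 * Re w"
      unfolding cmod_power2 by (simp add: power2_eq_square algebra_simps)
    ultimately show ?thesis
      unfolding norm_divide power_divide by (simp add: diff_divide_distrib)
  qed
  have "cmod ((a - 1) / (a + 1)) \<le> cmod ((b - 1) / (b + 1)) \<longleftrightarrow>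
      (cmod ((a - 1) / (a + 1)))\<^sup>2 \<le> (cmod ((b - 1) / (b + 1)))\<^sup>2"
    by (simp add: power_mono_iff)
  also have "\<dots> \<longleftrightarrow> Re b / (cmod (b + 1))\<^sup>2 \<le> Re a / (cmod (a + 1))\<^sup>2"
    unfolding eq[OF assms(1)] eq[OF assms(2)] by linarith
  finally show ?thesis .
qed

context koenigs_map
begin

lemma total_speed_disc_flow:
  "total_speed disc_flow t = hyperbolic_dist 0 ((flow t 1 - 1) / (flow t 1 + 1))"
  by (simp add: total_speed_def disc_flow_def)

section \<open>Self-similarity rules out eventual monotonicity\<close>

text \<open>The derivative of \<open>Re (1 / g s)\<close>, where \<open>g\<close> inverts
  \<open>h\<close>, is -Re (1 / (w^2 h'(w))). A number and its reciprocal have real parts of the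
  same sign, so \<open>neg\<close> makes this derivative positive.\<close>

lemma exists_later_Re_inverse_less:
  assumes w: "0 < Re w" and s: "h w = of_real s" and neg: "Re (w\<^sup>2 * deriv h w) < 0"
  shows "\<exists>w' s'. 0 < Re w' \<and> h w' = of_real s' \<and> s < s' \<and> Re (inverse w) < Re (inverse w')"
proof -
  obtain g where g: "g holomorphic_on h ` right_half_plane"
    "\<And>z. z \<in> right_half_plane \<Longrightarrow> deriv h z * deriv g (h z) = 1"
    "\<And>z. z \<in> right_half_plane \<Longrightarrow> g (h z) = z"
    using holomorphic_has_inverse[OF holo open_halfspace_Re_gt inj] by metis
  define D where "D = deriv g (of_real s)"
  have D: "deriv h w * D = 1" and gs: "g (of_real s) = w"
    using g(2,3)[of w] w s by (auto simp: D_def)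
  have w0: "w \<noteq> 0" using w by auto
  have "(g has_field_derivative D) (at (of_real s))"
    unfolding D_def using holomorphic_derivI[OF g(1) open_image] w s by (metis image_eqI mem_Collect_eq)
  then have "((\<lambda>z. inverse (g z)) has_field_derivative - (inverse w * D * inverse w)) (at (of_real s))"
    using DERIV_inverse'[of g D "of_real s" UNIV] w0 gs by simp
  then have der: "((\<lambda>x. Re (inverse (g (of_real x)))) has_real_derivative
      Re (- (inverse w * D * inverse w))) (at s)"
    by (intro has_field_derivative_Re has_vector_derivative_real_field)
  have "D = inverse (deriv h w)" using inverse_unique[OF D] by simp
  then have "- (inverse w * D * inverse w) = - inverse (w\<^sup>2 * deriv h w)"
    by (simp add: power2_eq_square)
  moreover have "0 < Re (- inverse (w\<^sup>2 * deriv h w))"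
    using neg by (simp add: Re_divide divide_less_0_iff sum_power2_gt_zero_iff inverse_eq_divide)
  ultimately have "0 < Re (- (inverse w * D * inverse w))" by simp
  then obtain d where d: "0 < d"
    "\<And>e. 0 < e \<Longrightarrow> e < d \<Longrightarrow> Re (inverse (g (of_real s))) < Re (inverse (g (of_real (s + e))))"
    using DERIV_pos_inc_right[OF der] by blast
  \<comment> \<open>Flowing from \<open>w\<close> ensures that \<open>s + d / 2\<close> is again a
    value of \<open>h\<close>, so that \<open>g\<close> is the inverse there.\<close>
  define w' where "w' = flow (d / 2) w"
  have w': "0 < Re w'" "h w' = of_real (s + d / 2)"
    using Re_flow[OF w, of "d / 2"] h_flow[OF w, of "d / 2"] d(1) by (auto simp: w'_def s)
  then have "g (of_real (s + d / 2)) = w'" using g(3)[of w'] by simp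
  then have "Re (inverse w) < Re (inverse w')" using d(2)[of "d / 2"] d(1) gs by simp
  with w' d(1) show ?thesis by (intro exI[of _ w'] exI[of _ "s + d / 2"]) simp
qed

text \<open>At time \<open>L ^ n * s\<close> the orbit of 1 has \<open>h\<close>-value
  \<open>h 1 + L ^ n * s\<close>, while \<open>L ^ n * w\<close> has \<open>h\<close>-value
  \<open>L ^ n * s\<close>. By \<open>dist_le\<close> the two points differ by at most |h 1|, which
  vanishes after division by \<open>L ^ n\<close>.\<close>

lemma rescaled_orbit_tendsto:
  assumes L: "1 < L" and scale: "\<And>w. 0 < Re w \<Longrightarrow> h (of_real L * w) = of_real L * h w"
    and w: "0 < Re w" and s: "h w = of_real s" "0 < s"
  shows "(\<lambda>n. L ^ n * (Re (flow (L ^ n * s) 1) / (cmod (flow (L ^ n * s) 1 + 1))\<^sup>2))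
    \<longlonglongrightarrow> Re (inverse w)"
proof -
  define u where "u = (\<lambda>n. flow (L ^ n * s) 1 / of_real (L ^ n))"
  have Lpos: "0 < L ^ n" for n using L by simp
  have scale_n: "h (of_real (L ^ n) * w) = of_real (L ^ n) * h w" for n
  proof (induction n)
    case (Suc n)
    have "0 < Re (of_real (L ^ n) * w)" using w Lpos by simp
    then show ?case using scale[of "of_real (L ^ n) * w"] Suc by (simp add: mult.assoc)
  qed simp
  have bound: "cmod (u n - w) \<le> cmod (h 1) * (1 / L) ^ n" for n
  proof -
    have "cmod (flow (L ^ n * s) 1 - of_real (L ^ n) * w)
        \<le> cmod (h (flow (L ^ n * s) 1) - h (of_real (L ^ n) * w))"
      using Lpos[of n] w s by (intro dist_le Re_flow) auto
    also have "\<dots> = cmod (h 1)"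
      using Lpos[of n] s by (subst h_flow) (auto simp: scale_n simp del: of_real_power)
    finally have *: "cmod (flow (L ^ n * s) 1 - of_real (L ^ n) * w) \<le> cmod (h 1)" .
    have "u n - w = (flow (L ^ n * s) 1 - of_real (L ^ n) * w) / of_real (L ^ n)"
      using Lpos[of n] L by (simp add: u_def field_simps)
    then have "cmod (u n - w) = cmod (flow (L ^ n * s) 1 - of_real (L ^ n) * w) / L ^ n"
      using Lpos[of n] L by (simp add: norm_divide norm_power)
    then show ?thesis using divide_right_mono[OF *, of "L ^ n"] Lpos[of n]
      by (simp add: power_divide)
  qed
  have pow0: "(\<lambda>n. (1 / L) ^ n) \<longlonglongrightarrow> 0" using L by (intro LIMSEQ_power_zero) simp
  have "(\<lambda>n. u n - w) \<longlonglongrightarrow> 0"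
    by (rule Lim_null_comparison[OF always_eventually tendsto_mult_right_zero[OF pow0]])
      (use bound in auto)
  then have lim: "u \<longlonglongrightarrow> w" by (simp add: LIM_zero_iff)
  have w0: "w \<noteq> 0" using w by auto
  \<comment> \<open>After rescaling, the 1 in \<open>flow + 1\<close> becomes
    \<open>(1 / L) ^ n\<close> and disappears in the limit, leaving Re w / |w|^2 = Re (1/w).\<close>
  have "(\<lambda>n. Re (u n) / (cmod (u n + of_real ((1 / L) ^ n)))\<^sup>2)
      \<longlonglongrightarrow> Re w / (cmod (w + of_real 0))\<^sup>2"
    by (intro tendsto_intros lim pow0) (use w0 in auto)
  moreover have "Re (u n) / (cmod (u n + of_real ((1 / L) ^ n)))\<^sup>2 =
      L ^ n * (Re (flow (L ^ n * s) 1) / (cmod (flow (L ^ n * s) 1 + 1))\<^sup>2)" for n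
  proof -
    have "u n + of_real ((1 / L) ^ n) = (flow (L ^ n * s) 1 + 1) / of_real (L ^ n)"
      using L by (simp add: u_def power_divide add_divide_distrib)
    then have "cmod (u n + of_real ((1 / L) ^ n)) = cmod (flow (L ^ n * s) 1 + 1) / L ^ n"
      using L by (simp add: norm_divide norm_power)
    moreover have "Re (u n) = Re (flow (L ^ n * s) 1) / L ^ n"
      unfolding u_def by (simp only: Re_divide_of_real)
    ultimately show ?thesis
      using Lpos[of n] by (simp add: power_divide) (simp add: power2_eq_square)
  qed
  ultimately show ?thesis by (simp add: cmod_power2 Re_divide inverse_eq_divide)
qed

text \<open>An eventually increasing speed would order \<open>F\<close> at the times
  \<open>L ^ n * s\<close> < \<open>L ^ n * s'\<close> for all large \<open>n\<close>. Multiplying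
  by \<open>L ^ n\<close> and passing to the limit would give Re (1/w') \<le> Re (1/w).\<close>

lemma not_eventually_increasing_total_speed:
  assumes L: "1 < L" and scale: "\<And>w. 0 < Re w \<Longrightarrow> h (of_real L * w) = of_real L * h w"
    and w: "0 < Re w" and s: "h w = of_real s" "0 < s" and neg: "Re (w\<^sup>2 * deriv h w) < 0"
  shows "\<not> eventually_increasing (total_speed disc_flow)"
proof
  assume "eventually_increasing (total_speed disc_flow)"
  then obtain t0 where mono: "mono_on {t0..} (total_speed disc_flow)"
    unfolding eventually_increasing_def by blast
  obtain w' s' where w': "0 < Re w'" "h w' = of_real s'" "s < s'" "Re (inverse w) < Re (inverse w')"
    using exists_later_Re_inverse_less[OF w s(1) neg] by blast
  define F where "F = (\<lambda>t. Re (flow t 1) / (cmod (flow t 1 + 1))\<^sup>2)"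
  have lim: "(\<lambda>n. L ^ n * F (L ^ n * s)) \<longlonglongrightarrow> Re (inverse w)"
    "(\<lambda>n. L ^ n * F (L ^ n * s')) \<longlonglongrightarrow> Re (inverse w')"
    unfolding F_def using rescaled_orbit_tendsto[OF L scale] w s w' by auto
  have "filterlim (\<lambda>n. L ^ n * s) at_top sequentially"
    using filterlim_tendsto_pos_mult_at_top[OF tendsto_const s(2)
        filterlim_at_infinity_imp_norm_at_top[OF filterlim_realpow_sequentially_gt1[of L]]] L
    by (simp add: mult.commute)
  then have "\<forall>\<^sub>F n in sequentially. t0 \<le> L ^ n * s"
    by (simp add: filterlim_at_top)
  then have "\<forall>\<^sub>F n in sequentially. L ^ n * F (L ^ n * s') \<le> L ^ n * F (L ^ n * s)"
  proof eventually_elim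
    case (elim n)
    have Lpos: "0 < L ^ n" using L by simp
    have pos: "0 < Re (flow (L ^ n * r) 1)" if "0 < r" for r
      using Lpos that by (intro Re_flow) auto
    have "L ^ n * s \<le> L ^ n * s'" using w'(3) Lpos by simp
    then have "total_speed disc_flow (L ^ n * s) \<le> total_speed disc_flow (L ^ n * s')"
      using elim by (intro mono_onD[OF mono]) auto
    then have "F (L ^ n * s') \<le> F (L ^ n * s)"
      unfolding total_speed_disc_flow F_def using pos[of s] pos[of s'] s(2) w'(3)
      by (simp add: hyperbolic_dist_0_le_iff cmod_cayley_less_1 cmod_cayley_le_iff)
    then show ?case using Lpos by simp
  qed
  then have "Re (inverse w') \<le> Re (inverse w)"
    by (rule tendsto_le[OF trivial_limit_sequentially lim])
  with w'(4) show False by simp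
qed

end

section \<open>The explicit Koenigs map\<close>

definition log_periodic :: "complex \<Rightarrow> complex" where
  "log_periodic w = exp (4 * (\<i> * Ln w - of_real (pi / 2)))"

text \<open>Termwise primitive of \<open>\<i> M + 4 + 4 \<zeta> + \<zeta>^2\<close> with \<zeta> =
  \<open>log_periodic w\<close>: as \<zeta> is a constant times w^(4i), the functions w \<zeta> and
  w \<zeta>^2 have derivatives (1 + 4i) \<zeta> and (1 + 8i) \<zeta>^2.\<close>

definition koenigs_example :: "real \<Rightarrow> complex \<Rightarrow> complex" where
  "koenigs_example M w = w * (\<i> * of_real M + 4 + 4 * log_periodic w / (1 + 4 * \<i>)
     + (log_periodic w)\<^sup>2 / (1 + 8 * \<i>))"

text \<open>The modulus is exp (-4 arg w - 2 \<pi>), and arg w > -\<pi>/2. It approaches 1 at the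
  negative imaginary axis.\<close>

lemma cmod_log_periodic_less_1:
  assumes "0 < Re w"
  shows "cmod (log_periodic w) < 1"
proof -
  have "w \<noteq> 0" using assms by auto
  then have "\<bar>Im (Ln w)\<bar> < pi / 2" using Re_Ln_pos_lt assms by blast
  then show ?thesis by (simp add: log_periodic_def)
qed

lemma log_periodic_has_derivative:
  assumes "0 < Re w"
  shows "(log_periodic has_field_derivative log_periodic w * (4 * \<i> / w)) (at w)"
proof -
  have "w \<notin> \<real>\<^sub>\<le>\<^sub>0" using assms complex_nonpos_Reals_iff by auto
  then show ?thesis
    unfolding log_periodic_def[abs_def]
    by (auto intro!: derivative_eq_intros simp: field_simps)
qed

lemma koenigs_example_has_derivative:
  assumes "0 < Re w"
  shows "(koenigs_example M has_field_derivative \<i> * of_real M + (2 + log_periodic w)\<^sup>2) (at w)"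
proof -
  have w: "w \<noteq> 0" using assms by auto
  have ne: "1 + 4 * \<i> \<noteq> 0" "1 + 8 * \<i> \<noteq> 0" by (auto simp: complex_eq_iff)
  let ?z = "log_periodic w"
  have "(koenigs_example M has_field_derivative
      (\<i> * of_real M + 4 + 4 * ?z / (1 + 4 * \<i>) + ?z\<^sup>2 / (1 + 8 * \<i>))
      + w * (4 * (?z * (4 * \<i> / w)) / (1 + 4 * \<i>) + 2 * ?z * (?z * (4 * \<i> / w)) / (1 + 8 * \<i>))) (at w)"
    unfolding koenigs_example_def[abs_def]
    by (rule derivative_eq_intros log_periodic_has_derivative assms refl ne | simp)+
  also have "w * (4 * (?z * (4 * \<i> / w)) / (1 + 4 * \<i>) + 2 * ?z * (?z * (4 * \<i> / w)) / (1 + 8 * \<i>))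
      = 4 * ?z * (4 * \<i> / (1 + 4 * \<i>)) + ?z\<^sup>2 * (8 * \<i> / (1 + 8 * \<i>))"
  proof -
    have "w * (4 * (?z * (4 * \<i> / w)) / a + 2 * ?z * (?z * (4 * \<i> / w)) / b)
        = 4 * ?z * (4 * \<i> / a) + ?z\<^sup>2 * (8 * \<i> / b)" if "a \<noteq> 0" "b \<noteq> 0" for a b
      using w that by (simp add: field_simps power2_eq_square)
    then show ?thesis using ne by blast
  qed
  also have "4 * \<i> / (1 + 4 * \<i>) = 1 - 1 / (1 + 4 * \<i>)"
    using ne by (simp add: field_simps)
  also have "8 * \<i> / (1 + 8 * \<i>) = 1 - 1 / (1 + 8 * \<i>)"
    using ne by (simp add: field_simps)
  finally show ?thesis by (simp add: algebra_simps power2_eq_square)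
qed

text \<open>With |\<zeta>| < 1, the identity Re ((2 + \<zeta>)^2) = 2 (1 + Re \<zeta>)^2 + 2 -
  |\<zeta>|^2 gives the bound 1; the term \<open>\<i> M\<close> is purely imaginary.\<close>

lemma koenigs_map_example: "koenigs_map (koenigs_example M)"
proof
  show "koenigs_example M holomorphic_on right_half_plane"
    unfolding holomorphic_on_open[OF open_halfspace_Re_gt]
    using koenigs_example_has_derivative by blast
  fix w :: complex assume w: "0 < Re w"
  let ?z = "log_periodic w"
  have "(cmod ?z)\<^sup>2 < 1" using cmod_log_periodic_less_1[OF w] by (simp add: power_less_one_iff)
  moreover have "Re ((2 + ?z)\<^sup>2) = 2 * (1 + Re ?z)\<^sup>2 + 2 - (cmod ?z)\<^sup>2"
    unfolding cmod_power2 by (simp add: power2_eq_square algebra_simps)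
  moreover have "0 \<le> (1 + Re ?z)\<^sup>2" by simp
  ultimately have "1 \<le> Re ((2 + ?z)\<^sup>2)" by linarith
  then show "1 \<le> Re (deriv (koenigs_example M) w)"
    using DERIV_imp_deriv[OF koenigs_example_has_derivative[OF w]] by simp
qed

text \<open>Scaling by exp (\<pi>/2) adds \<pi>/2 to \<open>Ln w\<close>, hence 2 \<pi> i to the
  exponent of \<open>log_periodic\<close>.\<close>

lemma koenigs_example_scale:
  assumes "0 < Re w"
  shows "koenigs_example M (of_real (exp (pi / 2)) * w) = of_real (exp (pi / 2)) * koenigs_example M w"
proof -
  have "w \<noteq> 0" using assms by auto
  then have "Ln (of_real (exp (pi / 2)) * w) = of_real (pi / 2) + Ln w"
    using Ln_times_of_real[of "exp (pi / 2)" w] Ln_of_real[of "exp (pi / 2)"] by simp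
  then have "log_periodic (of_real (exp (pi / 2)) * w)
      = exp (4 * (\<i> * Ln w - of_real (pi / 2)) + of_real (2 * pi) * \<i>)"
    unfolding log_periodic_def by (simp add: algebra_simps)
  then have "log_periodic (of_real (exp (pi / 2)) * w) = log_periodic w"
    by (simp add: exp_add log_periodic_def mult.commute mult.left_commute)
  then show ?thesis by (simp add: koenigs_example_def)
qed

text \<open>
  At \<open>w = sin \<delta> - \<i> cos \<delta>\<close> the value of \<^const>\<open>log_periodic\<close> is the real number
  \<open>\<rho> = exp (- 4 \<delta>)\<close>, and \<open>M\<close> is determined by requiring that \<open>koenigs_example M w\<close> be real.
  As \<open>\<delta> \<rightarrow> 0\<close>, the real part of \<open>w\<^sup>2\<close> times the derivative tends to
  \<open>2 (4 + 4/17 + 1/65) - 9 < 0\<close>.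
\<close>

lemma koenigs_example_witness:
  "\<exists>M w s. 0 < Re w \<and> koenigs_example M w = of_real s \<and> 0 < s \<and>
    Re (w\<^sup>2 * deriv (koenigs_example M) w) < 0"
proof -
  define \<rho> where "\<rho> = (\<lambda>d::real. exp (- 4 * d))"
  \<comment> \<open>\<open>Q\<close> and \<open>M - B\<close> will be the real and imaginary parts
    of \<open>koenigs_example M w / w\<close>, and \<open>f d\<close> the real part of w^2 times the
    derivative for the chosen \<open>M\<close>.\<close>
  define Q where "Q = (\<lambda>d. 4 + 4 * \<rho> d / 17 + (\<rho> d)\<^sup>2 / 65)"
  define B where "B = (\<lambda>d. 16 * \<rho> d / 17 + 8 * (\<rho> d)\<^sup>2 / 65)"
  define f where "f = (\<lambda>d. 2 * Q d * (cos d)\<^sup>2 + 2 * B d * sin d * cos d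
    - (2 + \<rho> d)\<^sup>2 * ((cos d)\<^sup>2 - (sin d)\<^sup>2))"
  have "isCont f 0"
    unfolding f_def Q_def B_def \<rho>_def by (intro continuous_intros) auto
  then have "(f \<longlongrightarrow> f 0) (at_right 0)"
    using isCont_def filterlim_at_split by blast
  moreover have "f 0 < 0" by (simp add: f_def Q_def B_def \<rho>_def)
  ultimately have "\<forall>\<^sub>F d in at_right 0. f d < 0" by (rule order_tendstoD)
  moreover have "\<forall>\<^sub>F d in at_right 0. d \<in> {0<..<pi / 2}"
    by (rule eventually_at_right_real) simp
  ultimately have "\<forall>\<^sub>F d in at_right 0. f d < 0 \<and> d \<in> {0<..<pi / 2}" by (rule eventually_conj)
  then obtain d where d: "f d < 0" "0 < d" "d < pi / 2"
    using eventually_happens[of _ "at_right (0::real)"] by force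
  have sin: "0 < sin d" using d by (intro sin_gt_zero) auto
  have Q: "0 < Q d" by (auto simp: Q_def \<rho>_def intro!: add_pos_pos)
  define M where "M = Q d * cos d / sin d + B d"
  define w where "w = exp (\<i> * of_real (d - pi / 2))"
  have w: "Re w = sin d" "Im w = - cos d"
    by (simp_all add: w_def Re_exp Im_exp cos_diff sin_diff)
  have pos: "0 < Re w" using w sin by simp
  have "Ln w = \<i> * of_real (d - pi / 2)"
    unfolding w_def using d by (intro Ln_exp) auto
  then have "4 * (\<i> * Ln w - of_real (pi / 2)) = of_real (- 4 * d)"
    by (simp add: complex_eq_iff)
  then have "log_periodic w = exp (of_real (- 4 * d))"
    unfolding log_periodic_def by (rule arg_cong)
  then have z: "log_periodic w = of_real (\<rho> d)" by (simp only: \<rho>_def exp_of_real)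
  have inv: "1 / (1 + 4 * \<i>) = (1 - 4 * \<i>) / 17" "1 / (1 + 8 * \<i>) = (1 - 8 * \<i>) / 65"
    by (simp_all add: complex_eq_iff Re_divide Im_divide)
  have "koenigs_example M w = w * (\<i> * of_real M + 4 + 4 * of_real (\<rho> d) * (1 / (1 + 4 * \<i>))
      + of_real ((\<rho> d)\<^sup>2) * (1 / (1 + 8 * \<i>)))"
    by (simp add: koenigs_example_def z)
  also have "\<dots> = w * (of_real (Q d) + \<i> * of_real (M - B d))"
    unfolding inv Q_def B_def by (simp add: complex_eq_iff algebra_simps add_divide_distrib diff_divide_distrib)
  \<comment> \<open>The choice of \<open>M\<close> cancels the imaginary part; since
    \<open>M - B d\<close> = Q cos d / sin d, the real part is Q (sin d + cos^2 d / sin d).\<close>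
  also have "\<dots> = of_real (Q d / sin d)"
  proof -
    have "Q d * (cos d * cos d) + Q d * (sin d * sin d) = Q d"
      by (simp flip: distrib_left)
    then have "sin d * Q d + cos d * (Q d * cos d / sin d) = Q d / sin d"
      using sin by (simp add: field_simps)
    then show ?thesis using sin by (simp add: complex_eq_iff w M_def)
  qed
  finally have val: "koenigs_example M w = of_real (Q d / sin d)" .
  have "deriv (koenigs_example M) w = \<i> * of_real M + of_real ((2 + \<rho> d)\<^sup>2)"
    using DERIV_imp_deriv[OF koenigs_example_has_derivative[OF pos]] by (simp add: z)
  then have "Re (w\<^sup>2 * deriv (koenigs_example M) w) =
      2 * sin d * cos d * M - (2 + \<rho> d)\<^sup>2 * ((cos d)\<^sup>2 - (sin d)\<^sup>2)"
    by (simp add: w power2_eq_square[of w] del: of_real_power)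
      (simp add: algebra_simps power2_eq_square)
  also have "2 * sin d * cos d * M = 2 * Q d * (cos d)\<^sup>2 + 2 * B d * sin d * cos d"
    using sin by (simp add: M_def field_simps power2_eq_square)
  finally have "Re (w\<^sup>2 * deriv (koenigs_example M) w) < 0"
    using d(1) by (simp add: f_def)
  with pos val Q sin show ?thesis
    by (intro exI[of _ M] exI[of _ w] exI[of _ "Q d / sin d"]) simp
qed

theorem theorem1p2:
  shows "\<exists>\<phi> :: real \<Rightarrow> complex \<Rightarrow> complex.
           holomorphic_semigroup \<phi> \<and> non_elliptic \<phi> \<and>
           \<not> eventually_increasing (total_speed \<phi>)"
proof -
  obtain M w s where w: "0 < Re w" "koenigs_example M w = of_real s" "0 < s"
    "Re (w\<^sup>2 * deriv (koenigs_example M) w) < 0"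
    using koenigs_example_witness by blast
  interpret koenigs_map "koenigs_example M" by (rule koenigs_map_example)
  have "\<not> eventually_increasing (total_speed disc_flow)"
    using not_eventually_increasing_total_speed[OF _ koenigs_example_scale w] by simp
  then show ?thesis
    using holomorphic_semigroup_disc_flow non_elliptic_disc_flow by blast
qed

end
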